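(* Let $m\geq 3$ and let $G=S(3,1^{m-1})$ be the starlike tree of order $m+3$, i.e. the tree on vertices $o,x_1,\dots,x_m,y,z$ with edges $ox_1,\dots,ox_m$, $x_1y$ and $yz$. Let $H$ be a distance-balanced graph which contains $G$ as a spanning subgraph. Then $H$ is $r$-regular for some integer $r$ with $m\leq r\leq m+2$.
   Context: All graphs are finite and simple. For vertices $u,v$ of a graph $H$, $d_H(u,v)$ is the length of a shortest $u$–$v$ path. For an edge $xy$ of $H$, $W^H_{xy}=\{u\in V(H): d_H(u,x)<d_H(u,y)\}$. A graph $H$ is distance-balanced if $|W^H_{xy}|=|W^H_{yx}|$ for every edge $xy$ of $H$. A starlike tree is a tree with exactly one vertex of degree greater than two; $S(n_1^{\alpha_1},\dots,n_k^{\alpha_k})$ denotes the starlike tree in which deleting the central vertex leaves $\alpha_i$ paths with $n_i$ vertices for each $i$. *)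

theory Defs
  imports
    "Graph_Theory.Pair_Digraph"
    "Graph_Theory.Digraph_Component"
    "Graph_Theory.Digraph_Isomorphism"
    "Graph_Theory.Shortest_Path"
begin

text \<open>
  A finite simple graph is a \<^locale>\<open>pair_graph\<close>: a finite, loop-free, symmetric set of pairs,
  each undirected edge \<open>xy\<close> being represented by the two arcs \<open>(x, y)\<close> and \<open>(y, x)\<close>.
\<close>

text \<open>
  With unit weights, \<open>\<mu>\<close> is the infimum of the lengths of all walks from \<open>u\<close> to \<open>v\<close>; it is attained
  by a path, and is \<open>\<infinity>\<close> if \<open>v\<close> cannot be reached from \<open>u\<close>.
\<close>
definition graph_dist :: "'a pair_pre_digraph \<Rightarrow> 'a \<Rightarrow> 'a \<Rightarrow> ereal" where
  "graph_dist H u v = wf_digraph.\<mu> (with_proj H) (\<lambda>_. 1) u v"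

definition closer :: "'a pair_pre_digraph \<Rightarrow> 'a \<Rightarrow> 'a \<Rightarrow> 'a set" where
  "closer H x y = {u \<in> pverts H. graph_dist H u x < graph_dist H u y}"

definition distance_balanced :: "'a pair_pre_digraph \<Rightarrow> bool" where
  "distance_balanced H \<longleftrightarrow> (\<forall>(x, y) \<in> parcs H. card (closer H x y) = card (closer H y x))"

text \<open>In a \<^locale>\<open>pair_graph\<close> the out-degree of a vertex is its number of neighbours.\<close>
definition regular :: "nat \<Rightarrow> 'a pair_pre_digraph \<Rightarrow> bool" where
  "regular r H \<longleftrightarrow> (\<forall>v \<in> pverts H. out_degree (with_proj H) v = r)"

text \<open>
  The graph \<open>K\<close> below is a copy of \<open>G\<close>: the vertices of \<open>G\<close> and \<open>H\<close> may be of different types.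
\<close>
definition contains_spanning :: "'a pair_pre_digraph \<Rightarrow> 'b pair_pre_digraph \<Rightarrow> bool" where
  "contains_spanning H G \<longleftrightarrow>
    (\<exists>K :: 'a pair_pre_digraph.
       spanning (with_proj K) (with_proj H) \<and> digraph_iso (with_proj G) (with_proj K))"

datatype starlike_vertex = vo | vx nat | vy | vz

text \<open>The starlike tree \<open>S(3, 1\<^sup>m\<^sup>-\<^sup>1)\<close>, with centre \<open>vo\<close> and long arm \<open>vx 1, vy, vz\<close>.\<close>
definition starlike31_arcs :: "nat \<Rightarrow> starlike_vertex rel" where
  "starlike31_arcs m = {(vo, vx i) | i. i \<in> {1..m}} \<union> {(vx 1, vy), (vy, vz)}"

definition starlike31 :: "nat \<Rightarrow> starlike_vertex pair_pre_digraph" where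
  "starlike31 m =
     \<lparr> pverts = {vo, vy, vz} \<union> vx ` {1..m},
       parcs = starlike31_arcs m \<union> (starlike31_arcs m)\<inverse> \<rparr>"

lemma pair_graph_starlike31:
  assumes "m \<ge> 1"
  shows "pair_graph (starlike31 m)"
proof -
  have fin: "finite (starlike31_arcs m)"
    by (auto simp: starlike31_arcs_def)
  show ?thesis
    using assms
    by unfold_locales
       (auto simp: starlike31_def starlike31_arcs_def symmetric_def sym_def fin[unfolded starlike31_arcs_def])
qed

lemma card_pverts_starlike31: "card (pverts (starlike31 m)) = m + 3"
proof -
  have "card (vx ` {1..m}) = m"
    by (simp add: card_image inj_on_def)
  moreover have "vo \<notin> vx ` {1..m}" "vy \<notin> vx ` {1..m}" "vz \<notin> vx ` {1..m}"
    by auto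
  ultimately show ?thesis
    by (simp add: starlike31_def)
qed

end

theory Submission
  imports Defs
begin

text \<open>
  A connected distance-balanced graph of diameter at most 2 is regular: for an edge \<open>xy\<close> the set
  \<open>W\<^sub>x\<^sub>y\<close> is \<open>{x} \<union> (N[x] - N[y])\<close>. So it suffices to show that \<open>H\<close> has diameter at most 2. The non-neighbours
  of \<open>o\<close> lie in \<open>{y, z}\<close>, hence are pairwise adjacent. If \<open>z\<close> were at distance 3 from \<open>o\<close>, it would be
  a pendant vertex at \<open>y\<close>, and \<open>W\<^sub>z\<^sub>y = {z}\<close> would be smaller than \<open>W\<^sub>y\<^sub>z\<close>. If a neighbour \<open>x\<close> of \<open>o\<close> is
  adjacent to a non-neighbour of \<open>o\<close>, it is within distance 2 of all of them; otherwise
  \<open>W\<^sub>x\<^sub>o = {x}\<close>, and so \<open>W\<^sub>o\<^sub>x = {o}\<close> contains no vertex at distance greater than 2 from \<open>x\<close>.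
\<close>

section \<open>Distances as powers of the reflexive adjacency relation\<close>

abbreviation dist_le :: "'a pair_pre_digraph \<Rightarrow> nat \<Rightarrow> 'a \<Rightarrow> 'a \<Rightarrow> bool" where
  "dist_le H k u v \<equiv> (u, v) \<in> ((parcs H)\<^sup>=) ^^ k"

lemma relpow_reflcl_mono:
  assumes "(u, v) \<in> (R\<^sup>=) ^^ k" "k \<le> l"
  shows "(u, v) \<in> (R\<^sup>=) ^^ l"
  using assms(2,1) by (induction rule: dec_induct) auto

lemma relpow_reflcl_2:
  "(u, v) \<in> (R\<^sup>=) ^^ 2 \<longleftrightarrow> u = v \<or> (u, v) \<in> R \<or> (\<exists>w. (u, w) \<in> R \<and> (w, v) \<in> R)"
  by (auto simp: numeral_2_eq_2)

context pair_wf_digraph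
begin

text \<open>A step of the reflexive closure is an arc or a pause, so \<open>k\<close> steps amount
  to a walk of at most \<open>k\<close> arcs. The power relates every element to itself, while the
  empty walk must start at a vertex; hence the assumption on \<open>u\<close>.\<close>

lemma dist_le_iff_awalk:
  assumes "u \<in> pverts G"
  shows "dist_le G k u v \<longleftrightarrow> (\<exists>p. awalk u p v \<and> length p \<le> k)"
proof
  show "\<exists>p. awalk u p v \<and> length p \<le> k" if "dist_le G k u v"
    using that assms
  proof (induction k arbitrary: u)
    case 0
    then show ?case by (auto simp: awalk_Nil_iff)
  next
    case (Suc k)
    obtain w where w: "(u, w) \<in> (parcs G)\<^sup>=" "dist_le G k w v"
      using Suc.prems(1) by (meson relpow_Suc_D2)
    moreover have "w \<in> pverts G"
      using w(1) Suc.prems(2) in_arcsD2 by auto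
    ultimately obtain p where p: "awalk w p v" "length p \<le> k"
      using Suc.IH by blast
    show ?case
    proof (cases "u = w")
      case True
      then show ?thesis using p le_SucI by blast
    next
      case False
      then have "awalk u ((u, w) # p) v"
        using w(1) p(1) by (simp add: awalk_Cons_iff)
      then show ?thesis using p(2) by (metis Suc_le_mono length_Cons)
    qed
  qed
next
  have "dist_le G (length p) u v" if "awalk u p v" for p
    using that
  proof (induction p arbitrary: u)
    case Nil
    then show ?case by (simp add: awalk_Nil_iff)
  next
    case (Cons e p)
    then show ?case
      by (metis UnI1 awalk_Cons_iff length_Cons prod.collapse relpow_Suc_I2)
  qed
  then show "dist_le G k u v" if "\<exists>p. awalk u p v \<and> length p \<le> k"
    using that relpow_reflcl_mono by metis
qed

lemma awalk_cost_unit: "awalk_cost (\<lambda>_. 1) p = real (length p)"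
  by (induction p) auto

lemma graph_dist_le_iff:
  assumes "u \<in> pverts G"
  shows "graph_dist G u v \<le> ereal (real k) \<longleftrightarrow> dist_le G k u v"
proof
  assume le: "graph_dist G u v \<le> ereal (real k)"
  show "dist_le G k u v"
  proof (rule ccontr)
    assume "\<not> dist_le G k u v"
    \<comment> \<open>Lengths are integers, so every walk has at least \<open>Suc k\<close> arcs;
      this bound passes to the infimum, whereas a strict bound by \<open>k\<close> would only give
      \<ge>.\<close>
    then have "ereal (real (Suc k)) \<le> graph_dist G u v"
      unfolding graph_dist_def \<mu>_def dist_le_iff_awalk[OF assms]
      by (intro INF_greatest) (auto simp: awalk_cost_unit not_le)
    then have "ereal (real (Suc k)) \<le> ereal (real k)"
      using le by (rule order_trans)
    then show False by simp
  qed
next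
  assume "dist_le G k u v"
  then obtain p where "awalk u p v" "length p \<le> k"
    using dist_le_iff_awalk[OF assms] by blast
  then show "graph_dist G u v \<le> ereal (real k)"
    unfolding graph_dist_def
    by (intro order_trans[OF min_cost_le_walk_cost]) (auto simp: awalk_cost_unit)
qed

text \<open>A natural threshold separates the two distances, the smaller one being attained by a
  walk; this also covers an unreachable \<open>y\<close>.\<close>

lemma graph_dist_less_iff:
  assumes "u \<in> pverts G"
  shows "graph_dist G u x < graph_dist G u y \<longleftrightarrow> (\<exists>k. dist_le G k u x \<and> \<not> dist_le G k u y)"
proof
  assume "graph_dist G u x < graph_dist G u y"
  then obtain p where p: "awalk u p x" "ereal (real (length p)) < graph_dist G u y"
    unfolding graph_dist_def \<mu>_def[of _ u x] by (auto simp: INF_less_iff awalk_cost_unit)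
  then have "dist_le G (length p) u x" "\<not> dist_le G (length p) u y"
    using dist_le_iff_awalk[OF assms] graph_dist_le_iff[OF assms, of y "length p"] by auto
  then show "\<exists>k. dist_le G k u x \<and> \<not> dist_le G k u y" by blast
next
  assume "\<exists>k. dist_le G k u x \<and> \<not> dist_le G k u y"
  then show "graph_dist G u x < graph_dist G u y"
    using graph_dist_le_iff[OF assms] by (meson not_le order_le_less_trans)
qed

lemma closer_iff:
  "u \<in> closer G x y \<longleftrightarrow> u \<in> pverts G \<and> (\<exists>k. dist_le G k u x \<and> \<not> dist_le G k u y)"
  unfolding closer_def using graph_dist_less_iff by blast

end

section \<open>Diameter at most 2 implies regularity\<close>

definition closed_nbhd :: "'a pair_pre_digraph \<Rightarrow> 'a \<Rightarrow> 'a set" where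
  "closed_nbhd H v = insert v {w. (v, w) \<in> parcs H}"

context pair_graph
begin

lemma arc_sym: "(u, v) \<in> parcs G \<Longrightarrow> (v, u) \<in> parcs G"
  using arcs_symmetric by blast

lemma no_loop: "(u, u) \<notin> parcs G"
  using pair_no_loops by fastforce

lemma dist_le_2_sym: "dist_le G 2 u v \<Longrightarrow> dist_le G 2 v u"
  unfolding relpow_reflcl_2 using arc_sym by blast

lemma finite_closer: "finite (closer G x y)"
  using pair_finite_verts by (auto simp: closer_def)

lemma finite_closed_nbhd: "finite (closed_nbhd G v)"
proof -
  have "closed_nbhd G v \<subseteq> insert v (pverts G)"
    using in_arcsD2 by (auto simp: closed_nbhd_def)
  then show ?thesis
    using pair_finite_verts finite_subset by blast
qed

lemma card_closed_nbhd: "card (closed_nbhd G v) = Suc (out_degree G v)"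
proof -
  have "out_arcs G v = Pair v ` {w. (v, w) \<in> parcs G}"
    by (auto simp: out_arcs_def)
  then have "out_degree G v = card {w. (v, w) \<in> parcs G}"
    unfolding out_degree_def by (simp add: card_image inj_on_def)
  moreover have "finite {w. (v, w) \<in> parcs G}"
    using finite_closed_nbhd[of v] by (simp add: closed_nbhd_def)
  ultimately show ?thesis
    using no_loop by (simp add: closed_nbhd_def)
qed

text \<open>A threshold separating \<open>x\<close> from \<open>y\<close> must be 0 or 1, since at 2
  every vertex already reaches \<open>y\<close>. Bounding distances to \<open>y\<close> alone makes
  the formula usable before the diameter is known.\<close>

lemma closer_eq_if_dist_le_2:
  assumes "\<And>u. u \<in> pverts G \<Longrightarrow> dist_le G 2 u y" and xy: "(x, y) \<in> parcs G"
  shows "closer G x y = insert x (closed_nbhd G x - closed_nbhd G y)"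
proof (intro set_eqI iffI)
  fix u assume "u \<in> closer G x y"
  then obtain k where k: "dist_le G k u x" "\<not> dist_le G k u y" and u: "u \<in> pverts G"
    by (auto simp: closer_iff)
  have "k < 2"
    using k(2) relpow_reflcl_mono[OF assms(1)[OF u]] by (meson not_le)
  then consider "k = 0" | "k = 1" by linarith
  then show "u \<in> insert x (closed_nbhd G x - closed_nbhd G y)"
    using k arc_sym by cases (auto simp: closed_nbhd_def)
next
  fix u assume u: "u \<in> insert x (closed_nbhd G x - closed_nbhd G y)"
  then have "u \<in> pverts G"
    using xy in_arcsD1 in_arcsD2 by (auto simp: closed_nbhd_def)
  moreover have "dist_le G 0 u x \<and> \<not> dist_le G 0 u y \<or> dist_le G 1 u x \<and> \<not> dist_le G 1 u y"
    using u arc_sym no_loop xy by (auto simp: closed_nbhd_def)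
  ultimately show "u \<in> closer G x y"
    unfolding closer_iff by blast
qed

lemma out_degree_eq_if_diameter_le_2:
  assumes balanced: "distance_balanced G"
    and diam: "\<And>u v. u \<in> pverts G \<Longrightarrow> v \<in> pverts G \<Longrightarrow> dist_le G 2 u v"
    and xy: "(x, y) \<in> parcs G"
  shows "out_degree G x = out_degree G y"
proof -
  let ?A = "closed_nbhd G x" and ?B = "closed_nbhd G y"
  have "closer G x y = insert x (?A - ?B)" "closer G y x = insert y (?B - ?A)"
    using diam xy arc_sym in_arcsD1 in_arcsD2 by (auto intro!: closer_eq_if_dist_le_2)
  \<comment> \<open>Both inserted endpoints are new elements, so balance equates the two
    differences; adding the common part \<open>?A\<close> \<inter> \<open>?B\<close> then equates
    the neighbourhoods.\<close>
  moreover have "x \<notin> ?A - ?B" "y \<notin> ?B - ?A"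
    using xy arc_sym by (auto simp: closed_nbhd_def)
  ultimately have "card (?A - ?B) = card (?B - ?A)"
    using balanced xy finite_closed_nbhd by (auto simp: distance_balanced_def)
  then have "card ?A = card ?B"
    using card_Int_Diff[OF finite_closed_nbhd] by (metis Int_commute)
  then show ?thesis by (simp add: card_closed_nbhd)
qed

lemma regular_if_diameter_le_2:
  assumes "distance_balanced G"
    and diam: "\<And>u v. u \<in> pverts G \<Longrightarrow> v \<in> pverts G \<Longrightarrow> dist_le G 2 u v"
    and c: "c \<in> pverts G"
  shows "regular (out_degree G c) G"
  unfolding regular_def
proof
  fix v assume "v \<in> pverts G"
  then have "dist_le G 2 v c" using diam c by blast
  \<comment> \<open>At most two arcs lead from \<open>v\<close> to \<open>c\<close>, and the degree
    is constant along each.\<close>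
  then show "out_degree G v = out_degree G c"
    unfolding relpow_reflcl_2 using out_degree_eq_if_diameter_le_2[OF assms(1) diam] by metis
qed

section \<open>Bounding the diameter\<close>

text \<open>A walk from another vertex to \<open>z\<close> has to pass through \<open>y\<close>
  first, so \<open>y\<close> is at least as near.\<close>

lemma closer_pendant_subset:
  assumes pendant: "\<And>u. (u, z) \<in> parcs G \<Longrightarrow> u = y"
  shows "closer G z y \<subseteq> {z}"
proof -
  have "u = z \<or> dist_le G k u y" if "dist_le G k u z" for u k
    using that
  proof (induction k)
    case 0
    then show ?case by simp
  next
    case (Suc k)
    then obtain w where w: "dist_le G k u w" "(w, z) \<in> (parcs G)\<^sup>="
      by auto
    then consider "w = z" | "w = y" using pendant by blast
    then show ?case
      using w(1) Suc.IH relpow_reflcl_mono[of u y k "parcs G" "Suc k"] by cases auto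
  qed
  then show ?thesis unfolding closer_iff subset_iff by blast
qed

lemma dist_le_2_of_long_arm_end:
  assumes balanced: "distance_balanced G"
    and verts: "pverts G \<subseteq> closed_nbhd G c \<union> {y, z}"
    and arcs: "(c, a) \<in> parcs G" "(a, y) \<in> parcs G" "(y, z) \<in> parcs G"
  shows "dist_le G 2 z c"
proof (rule ccontr)
  assume far: "\<not> dist_le G 2 z c"
  have "u = y" if "(u, z) \<in> parcs G" for u
  proof (rule ccontr)
    assume "u \<noteq> y"
    moreover have "u \<in> pverts G" "u \<noteq> z"
      using that in_arcsD1 no_loop by auto
    ultimately have "u = c \<or> (c, u) \<in> parcs G"
      using verts by (auto simp: closed_nbhd_def)
    \<comment> \<open>The path through \<open>u\<close> would put \<open>z\<close> within distance 2
      of \<open>c\<close>.\<close>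
    then show False
      using far that arc_sym unfolding relpow_reflcl_2 by blast
  qed
  then have "closer G z y \<subseteq> {z}" by (rule closer_pendant_subset)
  then have "card (closer G z y) \<le> 1"
    using card_mono[of "{z}"] by simp
  \<comment> \<open>The contradiction comes from two distinct members of
    \<open>closer G y z\<close>: \<open>c\<close>, with threshold 2, and \<open>y\<close>, with
    threshold 0.\<close>
  moreover have "c \<noteq> y" "y \<noteq> z"
    using far arcs(3) arc_sym no_loop unfolding relpow_reflcl_2 by blast+
  moreover have "dist_le G 2 c y" "\<not> dist_le G 2 c z"
    using arcs(1,2) far dist_le_2_sym unfolding relpow_reflcl_2[of c y] by blast+
  then have "c \<in> closer G y z"
    using arcs(1) in_arcsD1 unfolding closer_iff by blast
  moreover have "dist_le G 0 y y" "\<not> dist_le G 0 y z"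
    using \<open>y \<noteq> z\<close> by auto
  then have "y \<in> closer G y z"
    using arcs(2) in_arcsD2 unfolding closer_iff by blast
  ultimately have "card (closer G z y) < card (closer G y z)"
    using card_mono[OF finite_closer, of "{c, y}" y z] by simp
  then show False
    using balanced arcs(3) by (auto simp: distance_balanced_def)
qed

lemma dist_le_2_of_neighbour:
  assumes balanced: "distance_balanced G"
    and ecc: "\<And>u. u \<in> pverts G \<Longrightarrow> dist_le G 2 u c"
    and clique: "\<And>u v. \<lbrakk>u \<in> pverts G - closed_nbhd G c; v \<in> pverts G - closed_nbhd G c; u \<noteq> v\<rbrakk>
      \<Longrightarrow> (u, v) \<in> parcs G"
    and cx: "(c, x) \<in> parcs G" and w: "w \<in> pverts G - closed_nbhd G c"
  shows "dist_le G 2 w x"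
proof (cases "\<exists>r \<in> pverts G - closed_nbhd G c. (r, x) \<in> parcs G")
  case True
  \<comment> \<open>Either \<open>w\<close> is \<open>r\<close> itself, or the clique supplies the
    path from \<open>w\<close> through \<open>r\<close> to \<open>x\<close>.\<close>
  then show ?thesis
    using clique[OF w] unfolding relpow_reflcl_2 by metis
next
  case False
  show ?thesis
  proof (rule ccontr)
    assume far: "\<not> dist_le G 2 w x"
    have "closed_nbhd G x - closed_nbhd G c \<subseteq> {x}"
      using False arc_sym in_arcsD1 unfolding closed_nbhd_def by blast
    then have "closer G x c = {x}"
      using closer_eq_if_dist_le_2[OF ecc] cx arc_sym by blast
    \<comment> \<open>Threshold 2 separates \<open>c\<close> from \<open>x\<close> as seen from
      \<open>w\<close>, so \<open>w\<close> joins \<open>c\<close> in this set and makes it larger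
      than \<open>{x}\<close>.\<close>
    moreover have "w \<in> closer G c x"
      using ecc w far unfolding closer_iff by blast
    moreover have "dist_le G 0 c c" "\<not> dist_le G 0 c x"
      using cx no_loop by auto
    then have "c \<in> closer G c x"
      using cx in_arcsD1 unfolding closer_iff by blast
    moreover have "c \<noteq> w"
      using w by (auto simp: closed_nbhd_def)
    ultimately have "card (closer G x c) < card (closer G c x)"
      using card_mono[OF finite_closer, of "{c, w}" c x] by simp
    then show False
      using balanced cx by (auto simp: distance_balanced_def)
  qed
qed

text \<open>Pairs meeting the set \<open>?R\<close> of non-neighbours of \<open>c\<close> are
  settled by the two preceding bounds and the clique property; any other pair is joined through
  \<open>c\<close>.\<close>

lemma diameter_le_2:
  assumes balanced: "distance_balanced G"
    and verts: "pverts G \<subseteq> closed_nbhd G c \<union> {y, z}"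
    and arcs: "(c, a) \<in> parcs G" "(a, y) \<in> parcs G" "(y, z) \<in> parcs G"
    and uv: "u \<in> pverts G" "v \<in> pverts G"
  shows "dist_le G 2 u v"
proof -
  let ?R = "pverts G - closed_nbhd G c"
  have nbhd: "dist_le G 2 s c" if "s \<in> closed_nbhd G c" for s
    using that arc_sym unfolding relpow_reflcl_2 closed_nbhd_def by blast
  have "dist_le G 2 y c"
    using arcs arc_sym unfolding relpow_reflcl_2 by blast
  then have ecc: "dist_le G 2 s c" if "s \<in> pverts G" for s
    using that verts nbhd dist_le_2_of_long_arm_end[OF balanced verts arcs] by blast
  have clique: "(s, t) \<in> parcs G" if "s \<in> ?R" "t \<in> ?R" "s \<noteq> t" for s t
    using that verts arcs(3) arc_sym by blast
  have R: "dist_le G 2 s t" if s: "s \<in> ?R" and t: "t \<in> pverts G" for s t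
  proof -
    consider "t = c" | "(c, t) \<in> parcs G" | "t \<in> ?R"
      using t by (auto simp: closed_nbhd_def)
    then show ?thesis
    proof cases
      case 1
      then show ?thesis using ecc s by blast
    next
      case 2
      then show ?thesis using dist_le_2_of_neighbour[OF balanced ecc clique] s by blast
    next
      case 3
      then show ?thesis using clique s unfolding relpow_reflcl_2 by blast
    qed
  qed
  show ?thesis
  proof (cases "u \<in> ?R \<or> v \<in> ?R")
    case True
    then show ?thesis using R uv dist_le_2_sym by blast
  next
    case False
    then have "u \<in> closed_nbhd G c" "v \<in> closed_nbhd G c" using uv by auto
    then show ?thesis
      using arc_sym unfolding relpow_reflcl_2 closed_nbhd_def by blast
  qed
qed

end

section \<open>The embedded tree and the degree bounds\<close>

text \<open>Only a vertex bijection preserving arcs is kept from the isomorphic copy.\<close>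

lemma contains_spanningE:
  assumes "contains_spanning H G"
  obtains f where "inj_on f (pverts G)" "f ` pverts G = pverts H"
    "\<And>u v. (u, v) \<in> parcs G \<Longrightarrow> (f u, f v) \<in> parcs H"
proof -
  obtain K h where K: "spanning (with_proj K) (with_proj H)"
    and h: "pre_digraph.digraph_isomorphism (with_proj G) h"
    and app: "with_proj K = app_iso h (with_proj G)"
    using assms by (auto simp: contains_spanning_def digraph_iso_def)
  have "iso_verts h ` pverts G = pverts H"
    using K arg_cong[OF app, of verts] by (simp add: spanning_def)
  moreover have "(iso_verts h u, iso_verts h v) \<in> parcs H" if uv: "(u, v) \<in> parcs G" for u v
  proof -
    \<comment> \<open>The image is again a digraph of pairs, so its endpoint maps are the
      projections and the vertex map determines the arc map.\<close>
    have "iso_tail h = fst" "iso_head h = snd"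
      using arg_cong[OF app, of tail] arg_cong[OF app, of head] by simp_all
    then have "iso_arcs h (u, v) = (iso_verts h u, iso_verts h v)"
      using pre_digraph.iso_verts_tail[OF h, of "(u, v)"] pre_digraph.iso_verts_head[OF h, of "(u, v)"] uv
      by (simp add: prod_eq_iff)
    moreover have "iso_arcs h (u, v) \<in> parcs K"
      using arg_cong[OF app, of arcs] uv by simp
    ultimately show ?thesis
      using K by (auto simp: spanning_def subgraph_def)
  qed
  moreover have "inj_on (iso_verts h) (pverts G)"
    using pre_digraph.digraph_isomorphism_inj_on_verts[OF h] by simp
  ultimately show thesis using that by blast
qed

theorem theorem4p4:
  fixes m :: nat and H :: "'a pair_pre_digraph"
  assumes "m \<ge> 3"
    and "pair_graph H"
    and "distance_balanced H"
    and "contains_spanning H (starlike31 m)"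
  shows "\<exists>r. m \<le> r \<and> r \<le> m + 2 \<and> regular r H"
proof -
  interpret pair_graph H by fact
  obtain f where inj: "inj_on f (pverts (starlike31 m))"
    and verts: "f ` pverts (starlike31 m) = pverts H"
    and arcs: "\<And>u v. (u, v) \<in> parcs (starlike31 m) \<Longrightarrow> (f u, f v) \<in> parcs H"
    using contains_spanningE[OF assms(4)] by metis
  have c: "f vo \<in> pverts H"
    using verts by (auto simp: starlike31_def)
  have x: "(f vo, f (vx i)) \<in> parcs H" if "i \<in> {1..m}" for i
    using that by (intro arcs) (auto simp: starlike31_def starlike31_arcs_def)
  have "(f (vx 1), f vy) \<in> parcs H" "(f vy, f vz) \<in> parcs H"
    by (intro arcs; auto simp: starlike31_def starlike31_arcs_def)+
  moreover have "pverts H \<subseteq> closed_nbhd H (f vo) \<union> {f vy, f vz}"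
    unfolding verts[symmetric] using x by (auto simp: starlike31_def closed_nbhd_def)
  ultimately have "dist_le H 2 u v" if "u \<in> pverts H" "v \<in> pverts H" for u v
    using diameter_le_2[OF assms(3) _ x[of 1]] that assms(1) by auto
  then have "regular (out_degree H (f vo)) H"
    using regular_if_diameter_le_2[OF assms(3) _ c] by blast
  moreover have "m \<le> out_degree H (f vo)"
  proof -
    \<comment> \<open>The centre is included because a closed neighbourhood has one element more
      than the degree.\<close>
    let ?S = "insert vo (vx ` {1..m})"
    have "card ?S = Suc m"
      by (subst card_insert_disjoint) (auto simp: card_image inj_on_def)
    moreover have "inj_on f ?S"
      by (rule inj_on_subset[OF inj]) (auto simp: starlike31_def)
    ultimately have "card (f ` ?S) = Suc m"
      by (simp only: card_image)
    moreover have "f ` ?S \<subseteq> closed_nbhd H (f vo)"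
      using x by (auto simp: closed_nbhd_def)
    ultimately show ?thesis
      using card_mono[OF finite_closed_nbhd, of "f ` ?S" "f vo"] by (simp add: card_closed_nbhd)
  qed
  moreover have "out_degree H (f vo) \<le> m + 2"
  proof -
    \<comment> \<open>A closed neighbourhood has at most \<open>m + 3\<close> elements, and removing
      the centre leaves \<open>m + 2\<close>.\<close>
    have "closed_nbhd H (f vo) \<subseteq> pverts H"
      using c in_arcsD2 by (auto simp: closed_nbhd_def)
    then have "card (closed_nbhd H (f vo)) \<le> card (pverts H)"
      using pair_finite_verts card_mono by blast
    also have "\<dots> = m + 3"
      unfolding verts[symmetric] using card_image[OF inj] card_pverts_starlike31 by simp
    finally show ?thesis by (simp add: card_closed_nbhd)
  qed
  ultimately show ?thesis by blast
qed

end
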